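(* Let $A$ be a non-associative algebra over $\mathbb{C}$ equipped with a bilinear form $\langle\cdot,\cdot\rangle:A\times A\to\mathbb{C}$, and let $U$ be a complex vector space on which $A$ acts from the left (a bilinear map $A\times U\to U$, $(a,u)\mapsto au$). Assume that $U$ is equipped with a bilinear form $\langle\cdot,\cdot\rangle:U\times U\to\mathbb{C}$ and with a bilinear map $\circ:U\times U\to A$, $(u,v)\mapsto u\circ v$. Set $$\mathcal{L}(A,U)=A\otimes\mathbb{C}[t,t^{-1}]\oplus U\otimes\mathbb{C}[t,t^{-1}]\oplus\mathbb{C}K,$$ where $K$ is a nonzero element, viewed as a superspace with even part $A\otimes\mathbb{C}[t,t^{-1}]+\mathbb{C}K$ and odd part $U\otimes\mathbb{C}[t,t^{-1}]$. Define a bilinear operation $[\cdot,\cdot]$ on $\mathcal{L}(A,U)$ by \begin{align*} [a\otimes t^m,b\otimes t^n]&=\tfrac12(m-n)(ab)\otimes t^{m+n-1}+\tbinom{m}{3}\langle a,b\rangle\delta_{m+n-2,0}K,\\ [a\otimes t^m,u\otimes t^n]&=\tfrac14(m-2n)(au)\otimes t^{m+n-1},\\ [u\otimes t^n,a\otimes t^m]&=-[a\otimes t^m,u\otimes t^n],\\ [u\otimes t^m,v\otimes t^n]&=(u\circ v)\otimes t^{m+n}+\tfrac12 m(m-1)\langle u,v\rangle\delta_{m+n-1,0}K, \end{align*} for $a,b\in A$, $u,v\in U$, $m,n\in\mathbb{Z}$, and by requiring that the bracket of $K$ with every element (on either side) is $0$. Then $(\mathcal{L}(A,U),[\cdot,\cdot])$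 is a Lie superalgebra if and only if the following conditions are all satisfied: (i) $A$ is a commutative associative algebra and the bilinear form $\langle\cdot,\cdot\rangle$ on $A$ is symmetric and associative. (ii) $U$ is an $A$-module, and both the bilinear form $\langle\cdot,\cdot\rangle$ on $U$ and the bilinear map $\circ$ are symmetric. (iii) For all $a\in A$ and $u,v,w\in U$, $$\langle v,au\rangle=\langle u,av\rangle=\tfrac43\langle a,u\circ v\rangle,\qquad a(u\circ v)=v\circ au=u\circ av,\qquad (u\circ v)w=(v\circ w)u=(w\circ u)v.$$
   Context: All vector spaces are over $\mathbb{C}$. "Non-associative algebra" means a vector space with a bilinear multiplication, not necessarily associative, commutative or unital. $U$ being an $A$-module means $a(bu)=(ab)u$ for all $a,b\in A$, $u\in U$ (no unitality is involved). A bilinear form on $A$ is associative if $\langle ab,c\rangle=\langle a,bc\rangle$ for all $a,b,c\in A$. $\binom{m}{3}=m(m-1)(m-2)/6$ for all $m\in\mathbb{Z}$. A Lie superalgebra is a $\mathbb{Z}_2$-graded vector space $\mathfrak{g}=\mathfrak{g}_{\bar0}\oplus\mathfrak{g}_{\bar1}$ with a bilinear bracket satisfying $[\mathfrak{g}_\alpha,\mathfrak{g}_\beta]\subset\mathfrak{g}_{\alpha+\beta}$, $[x,y]=-(-1)^{|x||y|}[y,x]$ and $[x,[y,z]]-(-1)^{|x||y|}[y,[x,z]]=[[x,y],z]$ for homogeneous $x,y$ (and all $z$), where $|x|\in\{0,1\}$ is the parity of $x$. *)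

theory Defs
  imports
    Complex_Main
    "HOL-Library.Z2"
    "HOL-Library.Product_Plus"
    "HOL-Library.Poly_Mapping"
begin

definition bilinear_map ::
  "(complex \<Rightarrow> 'a::ab_group_add \<Rightarrow> 'a) \<Rightarrow> (complex \<Rightarrow> 'b::ab_group_add \<Rightarrow> 'b) \<Rightarrow>
   (complex \<Rightarrow> 'c::ab_group_add \<Rightarrow> 'c) \<Rightarrow> ('a \<Rightarrow> 'b \<Rightarrow> 'c) \<Rightarrow> bool"
  where "bilinear_map s1 s2 s3 f \<longleftrightarrow>
    (\<forall>x. Vector_Spaces.linear s2 s3 (f x)) \<and>
    (\<forall>y. Vector_Spaces.linear s1 s3 (\<lambda>x. f x y))"

text \<open>The grading group is the type \<open>bit\<close>, the field with two elements; \<open>G 0\<close> is the even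
  part and \<open>G 1\<close> the odd part.\<close>

locale lie_superalgebra = vector_space scale
  for scale :: "complex \<Rightarrow> 'g::ab_group_add \<Rightarrow> 'g" +
  fixes G :: "bit \<Rightarrow> 'g set"
    and br :: "'g \<Rightarrow> 'g \<Rightarrow> 'g"
  assumes subspace_G: "subspace (G \<alpha>)"
    and G_inter: "G 0 \<inter> G 1 = {0}"
    and G_sum: "\<exists>y\<in>G 0. \<exists>z\<in>G 1. x = y + z"
    and bilinear_br: "bilinear_map scale scale scale br"
    and br_graded: "x \<in> G \<alpha> \<Longrightarrow> y \<in> G \<beta> \<Longrightarrow> br x y \<in> G (\<alpha> + \<beta>)"
    and br_skew: "x \<in> G \<alpha> \<Longrightarrow> y \<in> G \<beta> \<Longrightarrow>
      br x y = - scale ((-1) ^ (of_bit \<alpha> * of_bit \<beta>)) (br y x)"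
    and br_jacobi: "x \<in> G \<alpha> \<Longrightarrow> y \<in> G \<beta> \<Longrightarrow>
      br x (br y z) - scale ((-1) ^ (of_bit \<alpha> * of_bit \<beta>)) (br y (br x z)) = br (br x y) z"

text \<open>\<open>V \<otimes> \<complex>[t, t\<^sup>-\<^sup>1]\<close> is realised as the space of finitely supported functions from
  the integers to \<open>V\<close>, with \<open>v \<otimes> t\<^sup>m\<close> being \<open>Poly_Mapping.single m v\<close>. The three
  components of \<open>superL\<close> are \<open>A \<otimes> \<complex>[t, t\<^sup>-\<^sup>1]\<close>, \<open>U \<otimes> \<complex>[t, t\<^sup>-\<^sup>1]\<close>
  and the coefficient of \<open>K\<close>.\<close>

type_synonym ('a, 'u) superL = "(int \<Rightarrow>\<^sub>0 'a) \<times> (int \<Rightarrow>\<^sub>0 'u) \<times> complex"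

definition tensA :: "'a::ab_group_add \<Rightarrow> int \<Rightarrow> ('a, 'u::ab_group_add) superL"
  where "tensA a m = (Poly_Mapping.single m a, 0, 0)"

definition tensU :: "'u::ab_group_add \<Rightarrow> int \<Rightarrow> ('a::ab_group_add, 'u) superL"
  where "tensU u m = (0, Poly_Mapping.single m u, 0)"

definition cK :: "('a::ab_group_add, 'u::ab_group_add) superL"
  where "cK = (0, 0, 1)"

definition scaleL ::
  "(complex \<Rightarrow> 'a::ab_group_add \<Rightarrow> 'a) \<Rightarrow> (complex \<Rightarrow> 'u::ab_group_add \<Rightarrow> 'u) \<Rightarrow>
   complex \<Rightarrow> ('a, 'u) superL \<Rightarrow> ('a, 'u) superL"
  where "scaleL sA sU c = (\<lambda>(p, q, k). (Poly_Mapping.map (sA c) p, Poly_Mapping.map (sU c) q, c * k))"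

definition gradeL :: "bit \<Rightarrow> ('a::ab_group_add, 'u::ab_group_add) superL set"
  where "gradeL \<alpha> = (if \<alpha> = 0 then {(p, 0, k) | p k. True} else {(0, q, 0) | q. True})"

text \<open>Extension of a family of maps \<open>f m n\<close>, prescribing the value at
  \<open>(v \<otimes> t\<^sup>m, w \<otimes> t\<^sup>n)\<close>, to all pairs; this is the bilinear extension when every
  \<open>f m n\<close> is bilinear.\<close>

definition laurent_ext ::
  "(int \<Rightarrow> int \<Rightarrow> 'v::zero \<Rightarrow> 'w::zero \<Rightarrow> 'c::comm_monoid_add) \<Rightarrow>
   (int \<Rightarrow>\<^sub>0 'v) \<Rightarrow> (int \<Rightarrow>\<^sub>0 'w) \<Rightarrow> 'c"
  where "laurent_ext f p q =
    (\<Sum>m\<in>Poly_Mapping.keys p. \<Sum>n\<in>Poly_Mapping.keys q.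
       f m n (Poly_Mapping.lookup p m) (Poly_Mapping.lookup q n))"

definition brAA ::
  "(complex \<Rightarrow> 'a::ab_group_add \<Rightarrow> 'a) \<Rightarrow> (complex \<Rightarrow> 'u::ab_group_add \<Rightarrow> 'u) \<Rightarrow>
   ('a \<Rightarrow> 'a \<Rightarrow> 'a) \<Rightarrow> ('a \<Rightarrow> 'a \<Rightarrow> complex) \<Rightarrow>
   int \<Rightarrow> int \<Rightarrow> 'a \<Rightarrow> 'a \<Rightarrow> ('a, 'u) superL"
  where "brAA sA sU mul formA m n a b =
    scaleL sA sU (1/2 * of_int (m - n)) (tensA (mul a b) (m + n - 1)) +
    scaleL sA sU (of_int (m * (m - 1) * (m - 2)) / 6 * formA a b * of_bool (m + n - 2 = 0)) cK"

definition brAU ::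
  "(complex \<Rightarrow> 'a::ab_group_add \<Rightarrow> 'a) \<Rightarrow> (complex \<Rightarrow> 'u::ab_group_add \<Rightarrow> 'u) \<Rightarrow>
   ('a \<Rightarrow> 'u \<Rightarrow> 'u) \<Rightarrow> int \<Rightarrow> int \<Rightarrow> 'a \<Rightarrow> 'u \<Rightarrow> ('a, 'u) superL"
  where "brAU sA sU act m n a u =
    scaleL sA sU (1/4 * of_int (m - 2 * n)) (tensU (act a u) (m + n - 1))"

definition brUU ::
  "(complex \<Rightarrow> 'a::ab_group_add \<Rightarrow> 'a) \<Rightarrow> (complex \<Rightarrow> 'u::ab_group_add \<Rightarrow> 'u) \<Rightarrow>
   ('u \<Rightarrow> 'u \<Rightarrow> complex) \<Rightarrow> ('u \<Rightarrow> 'u \<Rightarrow> 'a) \<Rightarrow>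
   int \<Rightarrow> int \<Rightarrow> 'u \<Rightarrow> 'u \<Rightarrow> ('a, 'u) superL"
  where "brUU sA sU formU circ m n u v =
    tensA (circ u v) (m + n) +
    scaleL sA sU (1/2 * of_int (m * (m - 1)) * formU u v * of_bool (m + n - 1 = 0)) cK"

definition bracketL ::
  "(complex \<Rightarrow> 'a::ab_group_add \<Rightarrow> 'a) \<Rightarrow> (complex \<Rightarrow> 'u::ab_group_add \<Rightarrow> 'u) \<Rightarrow>
   ('a \<Rightarrow> 'a \<Rightarrow> 'a) \<Rightarrow> ('a \<Rightarrow> 'a \<Rightarrow> complex) \<Rightarrow> ('a \<Rightarrow> 'u \<Rightarrow> 'u) \<Rightarrow>
   ('u \<Rightarrow> 'u \<Rightarrow> complex) \<Rightarrow> ('u \<Rightarrow> 'u \<Rightarrow> 'a) \<Rightarrow>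
   ('a, 'u) superL \<Rightarrow> ('a, 'u) superL \<Rightarrow> ('a, 'u) superL"
  where "bracketL sA sU mul formA act formU circ = (\<lambda>(p, q, k) (p', q', k').
    laurent_ext (brAA sA sU mul formA) p p' +
    laurent_ext (brAU sA sU act) p q' -
    laurent_ext (brAU sA sU act) p' q +
    laurent_ext (brUU sA sU formU circ) q q')"

lemma bilinear_mapD:
  assumes "bilinear_map s1 s2 s3 f"
  shows "f (x + x') y = f x y + f x' y" "f x (y + y') = f x y + f x y'"
    "f (s1 c x) y = s3 c (f x y)" "f x (s2 c y) = s3 c (f x y)"
    "f 0 y = 0" "f x 0 = 0"
    "vector_space s1" "vector_space s2" "vector_space s3"
proof -
  have l: "Vector_Spaces.linear s2 s3 (f x)" "Vector_Spaces.linear s1 s3 (\<lambda>x. f x y)" for x y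
    using assms by (auto simp: bilinear_map_def)
  interpret r: Vector_Spaces.linear s2 s3 "f x" by (rule l)
  interpret k: Vector_Spaces.linear s1 s3 "\<lambda>x. f x y" by (rule l)
  show "f (x + x') y = f x y + f x' y" by (rule k.add)
  show "f x (y + y') = f x y + f x y'" by (rule r.add)
  show "f (s1 c x) y = s3 c (f x y)" by (rule k.scale)
  show "f x (s2 c y) = s3 c (f x y)" by (rule r.scale)
  show "f 0 y = 0" by (rule k.zero)
  show "f x 0 = 0" by (rule r.zero)
  show "vector_space s1" "vector_space s2" "vector_space s3"
    by (rule k.vs1.vector_space_axioms r.vs1.vector_space_axioms r.vs2.vector_space_axioms)+
qed

lemma bilinear_mapI:
  assumes "vector_space s1" "vector_space s2" "vector_space s3"
    and "\<And>x x' y. f (x + x') y = f x y + f x' y"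
    and "\<And>x y y'. f x (y + y') = f x y + f x y'"
    and "\<And>c x y. f (s1 c x) y = s3 c (f x y)"
    and "\<And>c x y. f x (s2 c y) = s3 c (f x y)"
  shows "bilinear_map s1 s2 s3 f"
  using assms
  by (auto simp: bilinear_map_def Vector_Spaces.linear_def module_hom_def module_hom_axioms_def
      vector_space_def module_def)

lemma vector_space_map_scale:
  assumes "vector_space (s :: complex \<Rightarrow> 'a::ab_group_add \<Rightarrow> 'a)"
  shows "vector_space (\<lambda>c. Poly_Mapping.map (s c) :: (int \<Rightarrow>\<^sub>0 'a) \<Rightarrow> _)"
proof -
  interpret vector_space s by (rule assms)
  have lk: "Poly_Mapping.lookup (Poly_Mapping.map (s c) p) m = s c (Poly_Mapping.lookup p m)"
    for c m and p :: "int \<Rightarrow>\<^sub>0 'a"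
    by (simp add: Poly_Mapping.map.rep_eq when_def)
  show ?thesis
    by unfold_locales
      (auto intro!: poly_mapping_eqI simp: lk lookup_add scale_right_distrib scale_left_distrib)
qed

lemma vector_space_scaleL:
  assumes "vector_space sA" "vector_space sU"
  shows "vector_space (scaleL sA sU)"
proof -
  interpret A: vector_space "\<lambda>c. Poly_Mapping.map (sA c) :: (int \<Rightarrow>\<^sub>0 'a) \<Rightarrow> _"
    by (rule vector_space_map_scale[OF assms(1)])
  interpret U: vector_space "\<lambda>c. Poly_Mapping.map (sU c) :: (int \<Rightarrow>\<^sub>0 'b) \<Rightarrow> _"
    by (rule vector_space_map_scale[OF assms(2)])
  show ?thesis
    by unfold_locales
      (auto simp: scaleL_def A.scale_right_distrib A.scale_left_distrib
        U.scale_right_distrib U.scale_left_distrib algebra_simps)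
qed

lemma laurent_ext_superset:
  assumes "finite M" "finite N" "Poly_Mapping.keys p \<subseteq> M" "Poly_Mapping.keys q \<subseteq> N"
    and z: "\<And>m n x. f m n 0 x = 0" "\<And>m n x. f m n x 0 = 0"
  shows "laurent_ext f p q =
    (\<Sum>m\<in>M. \<Sum>n\<in>N. f m n (Poly_Mapping.lookup p m) (Poly_Mapping.lookup q n))"
proof -
  have "(\<Sum>n\<in>Poly_Mapping.keys q. f m n (Poly_Mapping.lookup p m) (Poly_Mapping.lookup q n)) =
    (\<Sum>n\<in>N. f m n (Poly_Mapping.lookup p m) (Poly_Mapping.lookup q n))" for m
    using assms by (intro sum.mono_neutral_left) (auto simp: in_keys_iff)
  then show ?thesis
    unfolding laurent_ext_def
    using assms by (simp, intro sum.mono_neutral_left) (auto simp: in_keys_iff)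
qed

lemma laurent_ext_single:
  assumes "\<And>m n. bilinear_map s1 s2 s3 (f m n)"
  shows "laurent_ext f (Poly_Mapping.single m v) (Poly_Mapping.single n w) = f m n v w"
  by (subst laurent_ext_superset[where M = "{m}" and N = "{n}"])
    (auto simp: bilinear_mapD(5,6)[OF assms])

lemma laurent_ext_zero [simp]: "laurent_ext f 0 q = 0" "laurent_ext f p 0 = 0"
  by (auto simp: laurent_ext_def)

lemma bilinear_laurent_ext:
  assumes b: "\<And>m n. bilinear_map s1 s2 s3 (f m n)"
  shows "bilinear_map (\<lambda>c. Poly_Mapping.map (s1 c)) (\<lambda>c. Poly_Mapping.map (s2 c)) s3 (laurent_ext f)"
proof -
  note bD = bilinear_mapD[OF b]
  interpret v1: vector_space s1 by (rule bD)
  interpret v2: vector_space s2 by (rule bD)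
  interpret v3: vector_space s3 by (rule bD)
  have lk: "Poly_Mapping.lookup (Poly_Mapping.map (s1 c) p) m = s1 c (Poly_Mapping.lookup p m)"
    "Poly_Mapping.lookup (Poly_Mapping.map (s2 c) q) m = s2 c (Poly_Mapping.lookup q m)"
    for c m p q
    by (simp_all add: Poly_Mapping.map.rep_eq when_def)
  have k: "Poly_Mapping.keys (Poly_Mapping.map (s1 c) p) \<subseteq> Poly_Mapping.keys p"
    "Poly_Mapping.keys (Poly_Mapping.map (s2 c) q) \<subseteq> Poly_Mapping.keys q" for c p q
    by (auto simp: in_keys_iff lk)
  note sup = laurent_ext_superset[of _ _ _ _ f, OF _ _ _ _ bD(5,6)]
  let ?K = Poly_Mapping.keys
  show ?thesis
  proof (rule bilinear_mapI)
    fix p p' q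
    show "laurent_ext f (p + p') q = laurent_ext f p q + laurent_ext f p' q"
      by (simp add: sup[of "?K p \<union> ?K p'" "?K q"] keys_add lookup_add bD sum.distrib)
  next
    fix p q q'
    show "laurent_ext f p (q + q') = laurent_ext f p q + laurent_ext f p q'"
      by (simp add: sup[of "?K p" "?K q \<union> ?K q'"] keys_add lookup_add bD sum.distrib)
  next
    fix c p q
    show "laurent_ext f (Poly_Mapping.map (s1 c) p) q = s3 c (laurent_ext f p q)"
      by (simp add: sup[of "?K p" "?K q"] k lk bD v3.scale_sum_right)
    show "laurent_ext f p (Poly_Mapping.map (s2 c) q) = s3 c (laurent_ext f p q)"
      by (simp add: sup[of "?K p" "?K q"] k lk bD v3.scale_sum_right)
  qed (intro vector_space_map_scale bD)+
qed

lemma tens_linear: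
  assumes "vector_space sA" "vector_space sU"
  shows "tensA (a + a') m = tensA a m + (tensA a' m :: ('a::ab_group_add, 'u::ab_group_add) superL)"
    "tensA (sA c a) m = scaleL sA sU c (tensA a m)"
    "tensU (u + u') m = tensU u m + (tensU u' m :: ('a::ab_group_add, 'u::ab_group_add) superL)"
    "tensU (sU c u) m = scaleL sA sU c (tensU u m)"
proof -
  interpret A: vector_space sA by fact
  interpret U: vector_space sU by fact
  show "tensA (a + a') m = tensA a m + (tensA a' m :: ('a, 'u) superL)"
    "tensA (sA c a) m = scaleL sA sU c (tensA a m)"
    "tensU (u + u') m = tensU u m + (tensU u' m :: ('a, 'u) superL)"
    "tensU (sU c u) m = scaleL sA sU c (tensU u m)"
    by (auto simp: tensA_def tensU_def scaleL_def single_add intro!: poly_mapping_eqI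
        simp: Poly_Mapping.map.rep_eq lookup_single when_def)
qed

lemma bilinear_brAA:
  assumes "vector_space sU" "bilinear_map sA sA sA mul" "bilinear_map sA sA (*) formA"
  shows "bilinear_map sA sA (scaleL sA sU) (brAA sA sU mul formA m n)"
proof -
  note vA = bilinear_mapD(7)[OF assms(2)]
  interpret L: vector_space "scaleL sA sU" by (rule vector_space_scaleL) fact+
  show ?thesis
    by (rule bilinear_mapI[OF vA vA L.vector_space_axioms])
      (simp_all add: brAA_def bilinear_mapD[OF assms(2)] bilinear_mapD[OF assms(3)]
        tens_linear[OF vA assms(1)] L.scale_right_distrib L.scale_left_distrib
        distrib_left distrib_right add_divide_distrib mult_ac)
qed

lemma bilinear_brAU:
  assumes "bilinear_map sA sU sU act"
  shows "bilinear_map sA sU (scaleL sA sU) (brAU sA sU act m n)"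
proof -
  note vA = bilinear_mapD(7)[OF assms] and vU = bilinear_mapD(8)[OF assms]
  interpret L: vector_space "scaleL sA sU" by (rule vector_space_scaleL) fact+
  show ?thesis
    by (rule bilinear_mapI[OF vA vU L.vector_space_axioms])
      (simp_all add: brAU_def bilinear_mapD[OF assms] tens_linear[OF vA vU]
        L.scale_right_distrib mult_ac)
qed

lemma bilinear_brUU:
  assumes "bilinear_map sU sU (*) formU" "bilinear_map sU sU sA circ"
  shows "bilinear_map sU sU (scaleL sA sU) (brUU sA sU formU circ m n)"
proof -
  note vA = bilinear_mapD(9)[OF assms(2)] and vU = bilinear_mapD(8)[OF assms(2)]
  interpret L: vector_space "scaleL sA sU" by (rule vector_space_scaleL) fact+
  show ?thesis
    by (rule bilinear_mapI[OF vU vU L.vector_space_axioms])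
      (simp_all add: brUU_def bilinear_mapD[OF assms(1)] bilinear_mapD[OF assms(2)]
        tens_linear[OF vA vU] L.scale_right_distrib L.scale_left_distrib
        distrib_left distrib_right add_divide_distrib mult_ac)
qed

text \<open>The next lemmas confirm that \<open>bracketL\<close> is bilinear and takes the prescribed values.\<close>

context
  fixes sA :: "complex \<Rightarrow> 'a::ab_group_add \<Rightarrow> 'a"
    and sU :: "complex \<Rightarrow> 'u::ab_group_add \<Rightarrow> 'u"
    and mul formA act formU circ
  assumes bil: "bilinear_map sA sA sA mul" "bilinear_map sA sA (*) formA"
    "bilinear_map sA sU sU act" "bilinear_map sU sU (*) formU" "bilinear_map sU sU sA circ"
begin

lemma bilinear_bracketL:
  "bilinear_map (scaleL sA sU) (scaleL sA sU) (scaleL sA sU)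
     (bracketL sA sU mul formA act formU circ)"
proof -
  have vA: "vector_space sA" and vU: "vector_space sU"
    using bilinear_mapD(7,8)[OF bil(3)] .
  interpret L: vector_space "scaleL sA sU" by (rule vector_space_scaleL[OF vA vU])
  note E1 = bilinear_mapD[OF bilinear_laurent_ext[OF bilinear_brAA[OF vU bil(1,2)]]]
  note E2 = bilinear_mapD[OF bilinear_laurent_ext[OF bilinear_brAU[OF bil(3)]]]
  note E3 = bilinear_mapD[OF bilinear_laurent_ext[OF bilinear_brUU[OF bil(4,5)]]]
  have sc: "scaleL sA sU c (p, q, k) =
    (Poly_Mapping.map (sA c) p, Poly_Mapping.map (sU c) q, c * k)" for c p q k
    by (simp add: scaleL_def)
  have pl: "(p, q, k) + (p', q', k') = (p + p', q + q', k + k')"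
    for p p' :: "int \<Rightarrow>\<^sub>0 'a" and q q' :: "int \<Rightarrow>\<^sub>0 'u" and k k' :: complex
    by simp
  have br: "bracketL sA sU mul formA act formU circ (p, q, k) (p', q', k') =
    laurent_ext (brAA sA sU mul formA) p p' + laurent_ext (brAU sA sU act) p q' -
    laurent_ext (brAU sA sU act) p' q + laurent_ext (brUU sA sU formU circ) q q'"
    for p q k p' q' k'
    by (simp add: bracketL_def)
  show ?thesis
  proof (rule bilinear_mapI[OF L.vector_space_axioms L.vector_space_axioms L.vector_space_axioms])
    fix x x' y :: "('a, 'u) superL" and c
    show "bracketL sA sU mul formA act formU circ (x + x') y =
      bracketL sA sU mul formA act formU circ x y + bracketL sA sU mul formA act formU circ x' y"
      by (cases x; cases x'; cases y) (simp only: pl br E1 E2 E3; simp only: algebra_simps)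
    show "bracketL sA sU mul formA act formU circ y (x + x') =
      bracketL sA sU mul formA act formU circ y x + bracketL sA sU mul formA act formU circ y x'"
      by (cases x; cases x'; cases y) (simp only: pl br E1 E2 E3; simp only: algebra_simps)
    show "bracketL sA sU mul formA act formU circ (scaleL sA sU c x) y =
      scaleL sA sU c (bracketL sA sU mul formA act formU circ x y)"
      by (cases x; cases y) (simp only: sc br E1 E2 E3 L.scale_right_distrib L.scale_right_diff_distrib)
    show "bracketL sA sU mul formA act formU circ x (scaleL sA sU c y) =
      scaleL sA sU c (bracketL sA sU mul formA act formU circ x y)"
      by (cases x; cases y) (simp only: sc br E1 E2 E3 L.scale_right_distrib L.scale_right_diff_distrib)
  qed
qed

lemma bracketL_values:
  "bracketL sA sU mul formA act formU circ (tensA a m) (tensA b n) =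
     scaleL sA sU (1/2 * of_int (m - n)) (tensA (mul a b) (m + n - 1)) +
     scaleL sA sU (of_int (m * (m - 1) * (m - 2)) / 6 * formA a b * of_bool (m + n - 2 = 0)) cK"
  "bracketL sA sU mul formA act formU circ (tensA a m) (tensU u n) =
     scaleL sA sU (1/4 * of_int (m - 2 * n)) (tensU (act a u) (m + n - 1))"
  "bracketL sA sU mul formA act formU circ (tensU u n) (tensA a m) =
     - bracketL sA sU mul formA act formU circ (tensA a m) (tensU u n)"
  "bracketL sA sU mul formA act formU circ (tensU u m) (tensU v n) =
     tensA (circ u v) (m + n) +
     scaleL sA sU (1/2 * of_int (m * (m - 1)) * formU u v * of_bool (m + n - 1 = 0)) cK"
  "bracketL sA sU mul formA act formU circ cK x = 0"
  "bracketL sA sU mul formA act formU circ x cK = 0"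
proof -
  have vU: "vector_space sU" using bilinear_mapD(8)[OF bil(3)] .
  note S = laurent_ext_single[OF bilinear_brAA[OF vU bil(1,2)]]
    laurent_ext_single[OF bilinear_brAU[OF bil(3)]]
    laurent_ext_single[OF bilinear_brUU[OF bil(4,5)]]
  show "bracketL sA sU mul formA act formU circ (tensA a m) (tensA b n) =
     scaleL sA sU (1/2 * of_int (m - n)) (tensA (mul a b) (m + n - 1)) +
     scaleL sA sU (of_int (m * (m - 1) * (m - 2)) / 6 * formA a b * of_bool (m + n - 2 = 0)) cK"
    by (subst (1 2) tensA_def) (simp add: bracketL_def S, simp add: brAA_def)
  show "bracketL sA sU mul formA act formU circ (tensA a m) (tensU u n) =
     scaleL sA sU (1/4 * of_int (m - 2 * n)) (tensU (act a u) (m + n - 1))"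
    by (subst tensA_def, subst tensU_def) (simp add: bracketL_def S, simp add: brAU_def)
  show "bracketL sA sU mul formA act formU circ (tensU u n) (tensA a m) =
     - bracketL sA sU mul formA act formU circ (tensA a m) (tensU u n)"
    by (simp add: bracketL_def tensA_def tensU_def)
  show "bracketL sA sU mul formA act formU circ (tensU u m) (tensU v n) =
     tensA (circ u v) (m + n) +
     scaleL sA sU (1/2 * of_int (m * (m - 1)) * formU u v * of_bool (m + n - 1 = 0)) cK"
    by (subst (1 2) tensU_def) (simp add: bracketL_def S, simp add: brUU_def)
  show "bracketL sA sU mul formA act formU circ cK x = 0"
    "bracketL sA sU mul formA act formU circ x cK = 0"
    by (cases x; simp add: bracketL_def cK_def)+
qed

end

end

theory Submission
  imports Defs
begin

text \<open>
  The bracket is bilinear and of degree zero for the parity, so being a Lie superalgebra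
  means skew-symmetry and the Jacobi identity. By additivity both need to be tested only on the
  monomials \<open>a \<otimes> t\<^sup>m\<close>, \<open>u \<otimes> t\<^sup>m\<close> and the multiples of \<open>K\<close>, and \<open>K\<close> is central.

  On monomials, the Jacobiator (left minus right side of the Jacobi identity) is a vector of \<open>A\<close>
  or \<open>U\<close> times one power of \<open>t\<close>, plus a multiple of \<open>K\<close>. Up to reordering the arguments there
  are four types, \<open>AAA\<close>, \<open>AAU\<close>, \<open>AUU\<close> and \<open>UUU\<close>; lemmas \<open>jac_AAA\<close> to \<open>jac_UUU\<close> compute
  them before any condition is imposed. The vector part is always a combination of three
  products, such as \<open>a(bc)\<close>, \<open>b(ac)\<close> and \<open>(ab)c\<close>, with coefficients polynomial in the
  exponents \<open>m\<close>, \<open>n\<close>, \<open>p\<close>. In the types \<open>AAA\<close> and \<open>AUU\<close> the coefficient of \<open>K\<close> has the same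
  shape, with values of the forms in place of products.

  If conditions (i)--(iii) hold, the three products agree, as do the values of the
  forms up to the factor \<open>4/3\<close> between the two forms, and the three polynomials cancel: these are the Jacobi identities of the
  Neveu--Schwarz algebra. The central terms cancel only where the Kronecker delta is nonzero,
  that is, after eliminating one exponent. The remaining orders of the arguments follow because, in a
  super-skew-symmetric algebra, swapping neighbours changes the Jacobiator only by a sign
  (\<open>jac_swap\<close>).

  Conversely, in a Lie superalgebra the exponents may be chosen so that one of the three
  coefficients vanishes and the other two do not. Each such choice makes two products, or two
  values of the forms, proportional. Together with the symmetry of the products and forms,
  which is read off from skew-symmetry, these relations give (i)--(iii).
\<close>

section \<open>Monomials and their brackets\<close>

lemma map_zero: "f 0 = 0 \<Longrightarrow> Poly_Mapping.map f 0 = 0"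
  by (rule poly_mapping_eqI) (simp add: Poly_Mapping.map.rep_eq)

lemma single_eq_0_iff: "Poly_Mapping.single m x = 0 \<longleftrightarrow> x = 0"
  by (metis lookup_single_eq lookup_zero single_zero)

text \<open>The shape of every central term below: \<open>Q\<close> is the condition in the Kronecker delta, so the
  polynomial identity is only required on the exponents satisfying it.\<close>

lemma int_scale_diff3_eq_0:
  fixes f :: complex
  assumes "Q \<Longrightarrow> i - j - k = 0"
  shows "of_bool Q * of_int i / d * f - of_bool Q * of_int j / d * f - of_bool Q * of_int k / d * f = 0"
proof (cases Q)
  case True
  then have "i = j + k" using assms by simp
  then show ?thesis by (simp add: field_simps add_divide_distrib)
qed simp

locale superL_data =
  fixes sA :: "complex \<Rightarrow> 'a::ab_group_add \<Rightarrow> 'a"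
    and sU :: "complex \<Rightarrow> 'u::ab_group_add \<Rightarrow> 'u"
    and mul :: "'a \<Rightarrow> 'a \<Rightarrow> 'a"
    and formA :: "'a \<Rightarrow> 'a \<Rightarrow> complex"
    and act :: "'a \<Rightarrow> 'u \<Rightarrow> 'u"
    and formU :: "'u \<Rightarrow> 'u \<Rightarrow> complex"
    and circ :: "'u \<Rightarrow> 'u \<Rightarrow> 'a"
  assumes bil: "bilinear_map sA sA sA mul" "bilinear_map sA sA (*) formA"
    "bilinear_map sA sU sU act" "bilinear_map sU sU (*) formU" "bilinear_map sU sU sA circ"
begin

abbreviation scl :: "complex \<Rightarrow> ('a, 'u) superL \<Rightarrow> ('a, 'u) superL"
  where "scl \<equiv> scaleL sA sU"

abbreviation br :: "('a, 'u) superL \<Rightarrow> ('a, 'u) superL \<Rightarrow> ('a, 'u) superL"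
  where "br \<equiv> bracketL sA sU mul formA act formU circ"

sublocale A: vector_space sA
  by (rule bilinear_mapD(7)[OF bil(3)])

sublocale U: vector_space sU
  by (rule bilinear_mapD(8)[OF bil(3)])

sublocale L: vector_space scl
  by (rule vector_space_scaleL[OF A.vector_space_axioms U.vector_space_axioms])

lemmas br_linear = bilinear_mapD(1-6)[OF bilinear_bracketL[OF bil]]
lemmas br_values = bracketL_values[OF bil]
lemmas tens_scale_add = tens_linear[OF A.vector_space_axioms U.vector_space_axioms]

lemma tens_0: "tensA 0 m = (0 :: ('a, 'u) superL)" "tensU 0 m = (0 :: ('a, 'u) superL)"
  unfolding tensA_def tensU_def zero_prod_def single_zero by simp_all

lemma tens_diff:
  "tensA (a - b) m = tensA a m - (tensA b m :: ('a, 'u) superL)"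
  "tensU (u - v) m = tensU u m - (tensU v m :: ('a, 'u) superL)"
  by (simp_all add: tensA_def tensU_def single_diff zero_prod_def)

lemma tensU_uminus: "tensU (- u) m = - (tensU u m :: ('a, 'u) superL)"
  using tens_diff(2)[of 0 u m] by (simp add: tens_0)

lemma tensU_eq_0_iff: "tensU u m = (0 :: ('a, 'u) superL) \<longleftrightarrow> u = 0"
  by (simp add: tensU_def zero_prod_def single_eq_0_iff)

lemma scl_cK: "scl k cK = (0, 0, k)"
  by (simp add: cK_def scaleL_def map_zero)

text \<open>The bracket of two even or two odd monomials has this form. Keeping the three pieces of data
  apart turns equations in the algebra into pairs of equations, one in \<open>A\<close> and one in \<open>\<complex>\<close>.\<close>

definition even_monom :: "'a \<Rightarrow> int \<Rightarrow> complex \<Rightarrow> ('a, 'u) superL"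
  where "even_monom x N k = tensA x N + scl k cK"

lemma even_monom_diff:
  "even_monom x N k - even_monom y N l = even_monom (x - y) N (k - l)"
  by (simp add: even_monom_def tens_diff L.scale_left_diff_distrib)

lemma even_monom_eq_0_iff: "even_monom x N k = 0 \<longleftrightarrow> x = 0 \<and> k = 0"
  by (simp add: even_monom_def scl_cK tensA_def zero_prod_def single_eq_0_iff)

lemma even_monom_eq_iff: "even_monom x N k = even_monom y N l \<longleftrightarrow> x = y \<and> k = l"
  using even_monom_eq_0_iff[of "x - y" N "k - l"] by (simp flip: even_monom_diff)

lemma even_monom_minus: "- even_monom x N k = even_monom (- x) N (- k)"
  using even_monom_diff[of 0 N 0 x k] even_monom_eq_0_iff[of 0 N 0] by simp

lemma br_AA:
  "br (tensA a m) (tensA b n) = even_monom (sA (of_int (m - n) / 2) (mul a b)) (m + n - 1)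
    (of_bool (m + n = 2) * of_int (m * (m - 1) * (m - 2)) / 6 * formA a b)"
  by (simp add: br_values even_monom_def tens_scale_add)

lemma br_UU:
  "br (tensU u m) (tensU v n) = even_monom (circ u v) (m + n)
    (of_bool (m + n = 1) * of_int (m * (m - 1)) / 2 * formU u v)"
  by (simp add: br_values even_monom_def)

section \<open>The Jacobiator on monomials\<close>

lemma br_A_AA:
  "br (tensA a m) (br (tensA b n) (tensA c p)) =
    even_monom (sA (of_int ((n - p) * (m - n - p + 1)) / 4) (mul a (mul b c))) (m + n + p - 2)
     (of_bool (m + n + p = 3) * of_int ((n - p) * (m * (m - 1) * (m - 2))) / 12 * formA a (mul b c))"
proof -
  have e: "m + (n + p - 1) - 1 = m + n + p - 2" "m + (n + p - 1) - 2 = 0 \<longleftrightarrow> m + n + p = 3"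
    "m - (n + p - 1) = m - n - p + 1"
    by auto
  show ?thesis unfolding even_monom_def
    by (simp only: br_values br_linear L.scale_right_distrib L.scale_zero_right add_0_right e tens_scale_add L.scale_scale)
     (intro arg_cong2[where f="(+)"] arg_cong2[where f=scl] refl; simp)
qed

lemma br_AA_A:
  "br (br (tensA a m) (tensA b n)) (tensA c p) =
    even_monom (sA (of_int ((m - n) * (m + n - 1 - p)) / 4) (mul (mul a b) c)) (m + n + p - 2)
    (of_bool (m + n + p = 3) * of_int ((m - n) * ((m + n - 1) * (m + n - 2) * (m + n - 3))) / 12 * formA (mul a b) c)"
proof -
  have e: "m + n - 1 + p - 1 = m + n + p - 2" "m + n - 1 + p - 2 = 0 \<longleftrightarrow> m + n + p = 3"
    "m + n - 1 - 1 = m + n - 2" "m + n - 1 - 2 = m + n - 3"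
    by auto
  show ?thesis unfolding even_monom_def
    by (simp only: br_values br_linear L.scale_right_distrib L.scale_zero_right add_0_right e tens_scale_add L.scale_scale)
     (intro arg_cong2[where f="(+)"] arg_cong2[where f=scl] refl; simp)
qed

text \<open>The parameter \<open>s\<close> stands for the sign \<open>(-1)\<^bsup>|x||y|\<^esup>\<close>.\<close>

definition jac :: "complex \<Rightarrow> ('a, 'u) superL \<Rightarrow> ('a, 'u) superL \<Rightarrow> ('a, 'u) superL \<Rightarrow> ('a, 'u) superL"
  where "jac s x y z = br x (br y z) - scl s (br y (br x z)) - br (br x y) z"

text \<open>The four formulas below use bilinearity only. This is what lets them serve both
  directions of the theorem: one direction substitutes the algebraic laws into them, the other
  extracts the laws from their vanishing.\<close>

lemma jac_AAA:
  "jac 1 (tensA a m) (tensA b n) (tensA c p) =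
    even_monom (sA (of_int ((n - p) * (m - n - p + 1)) / 4) (mul a (mul b c))
         - sA (of_int ((m - p) * (n - m - p + 1)) / 4) (mul b (mul a c))
         - sA (of_int ((m - n) * (m + n - 1 - p)) / 4) (mul (mul a b) c)) (m + n + p - 2)
     (of_bool (m + n + p = 3) * of_int ((n - p) * (m * (m - 1) * (m - 2))) / 12 * formA a (mul b c)
       - of_bool (m + n + p = 3) * of_int ((m - p) * (n * (n - 1) * (n - 2))) / 12 * formA b (mul a c)
       - of_bool (m + n + p = 3) * of_int ((m - n) * ((m + n - 1) * (m + n - 2) * (m + n - 3))) / 12 * formA (mul a b) c)"
proof -
  have e: "n + m + p = m + n + p" by simp
  show ?thesis
    unfolding jac_def br_A_AA br_AA_A e even_monom_diff L.scale_one ..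
qed

lemma jac_AAU:
  "jac 1 (tensA a m) (tensA b n) (tensU u p) =
    tensU (sU (of_int ((n - 2 * p) * (m - 2 * (n + p - 1))) / 16) (act a (act b u))
         - sU (of_int ((m - 2 * p) * (n - 2 * (m + p - 1))) / 16) (act b (act a u))
         - sU (of_int ((m - n) * (m + n - 1 - 2 * p)) / 8) (act (mul a b) u)) (m + n + p - 2)"
proof -
  have e: "m + (n + p - 1) - 1 = m + n + p - 2" "n + (m + p - 1) - 1 = m + n + p - 2"
    "m + n - 1 + p - 1 = m + n + p - 2"
    by auto
  show ?thesis unfolding jac_def tens_diff L.scale_one
    by (simp only: br_values br_linear L.scale_right_distrib L.scale_zero_right add_0_right e tens_scale_add L.scale_scale)
     (intro arg_cong2[where f="(-)"] arg_cong2[where f=scl] refl; simp)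
qed

lemma jac_AUU:
  "jac 1 (tensA a m) (tensU u n) (tensU v p) =
    even_monom (sA (of_int (m - n - p) / 2) (mul a (circ u v))
         - sA (of_int (m - 2 * p) / 4) (circ u (act a v))
         - sA (of_int (m - 2 * n) / 4) (circ (act a u) v)) (m + n + p - 1)
     (of_bool (m + n + p = 2) * of_int (m * (m - 1) * (m - 2)) / 6 * formA a (circ u v)
       - of_bool (m + n + p = 2) * of_int ((m - 2 * p) * (n * (n - 1))) / 8 * formU u (act a v)
       - of_bool (m + n + p = 2) * of_int ((m - 2 * n) * ((m + n - 1) * (m + n - 2))) / 8 * formU (act a u) v)"
proof -
  have e: "m + (n + p) - 1 = m + n + p - 1" "n + (m + p - 1) = m + n + p - 1"
    "m + n - 1 + p = m + n + p - 1"  "m - (n + p) = m - n - p" "m + n - 1 - 1 = m + n - 2"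
    "m + (n + p) - 2 = 0 \<longleftrightarrow> m + n + p = 2" "m + n + p - 1 - 1 = 0 \<longleftrightarrow> m + n + p = 2"
    by auto
  show ?thesis unfolding jac_def even_monom_diff[symmetric] L.scale_one  unfolding even_monom_def
    by (simp only: br_values br_linear L.scale_right_distrib L.scale_zero_right add_0_right e tens_scale_add L.scale_scale)
     (intro arg_cong2[where f="(-)"] arg_cong2[where f="(+)"] arg_cong2[where f=scl] refl; simp)
qed

lemma jac_UUU:
  "jac (-1) (tensU u m) (tensU v n) (tensU w p) =
    tensU (- sU (of_int (n + p - 2 * m) / 4) (act (circ v w) u)
         - sU (of_int (m + p - 2 * n) / 4) (act (circ u w) v)
         - sU (of_int (m + n - 2 * p) / 4) (act (circ u v) w)) (m + n + p - 1)"
proof -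
  have e: "n + p + m = m + n + p" "m + p + n = m + n + p" by auto
  \<comment> \<open>Since \<open>[v, a] = - [a, v]\<close>, this coefficient comes out negated.\<close>
  have "2 * n - (m + p) = - (m + p - 2 * n)" by simp
  then have "scl (1/4 * of_int (m + p - 2 * n)) x = - scl (1/4 * of_int (2 * n - (m + p))) x" for x
    by (simp only: of_int_minus mult_minus_right L.scale_minus_left minus_minus)
  then show ?thesis
    by (simp add: jac_def tens_diff tensU_uminus br_values br_linear L.scale_right_distrib
        e tens_scale_add)
qed

section \<open>Reduction to monomials\<close>

abbreviation koszul :: "bit \<Rightarrow> bit \<Rightarrow> complex"
  where "koszul \<alpha> \<beta> \<equiv> (-1) ^ (of_bit \<alpha> * of_bit \<beta>)"

definition gens :: "bit \<Rightarrow> ('a, 'u) superL set"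
  where "gens \<alpha> = (if \<alpha> = 0 then range (\<lambda>(a, m). tensA a m) \<union> range (\<lambda>k. scl k cK)
    else range (\<lambda>(u, m). tensU u m))"

lemma subspace_gradeL: "L.subspace (gradeL \<alpha>)"
  by (auto simp: L.subspace_def gradeL_def scaleL_def map_zero zero_prod_def)

lemma tens_in_gradeL: "tensA a m \<in> gradeL 0" "tensU u m \<in> gradeL 1" "scl k cK \<in> gradeL 0"
  by (auto simp: gradeL_def scl_cK tensA_def tensU_def)

lemma laurent_induct:
  fixes P :: "(int \<Rightarrow>\<^sub>0 'b::ab_group_add) \<Rightarrow> bool"
  assumes "\<And>m v. P (Poly_Mapping.single m v)" and "\<And>p q. P p \<Longrightarrow> P q \<Longrightarrow> P (p + q)"
  shows "P p"
proof (induction p rule: update_induct)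
  case const
  show ?case using assms(1)[of 0 0] by simp
next
  case (update p m v)
  have "Poly_Mapping.update m v p = p + Poly_Mapping.single m v"
    using update(1)
    by (intro poly_mapping_eqI) (auto simp: lookup_add lookup_single lookup_update when_def in_keys_iff)
  then show ?case using assms update by simp
qed

lemma gensI: "tensA a m \<in> gens 0" "tensU u m \<in> gens 1" "scl k cK \<in> gens 0"
  by (auto simp: gens_def)

text \<open>The coefficients of a Laurent polynomial are vectors, so a scalar multiple of a monomial is
  again a monomial; the multiples of \<open>K\<close> are all counted as generators for the same purpose.
  Sums of generators then exhaust each graded part.\<close>

lemma gradeL_induct [consumes 1, case_names gen add]:
  assumes x: "x \<in> gradeL \<alpha>" and gen: "\<And>x. x \<in> gens \<alpha> \<Longrightarrow> P x"
    and add: "\<And>x y. x \<in> gradeL \<alpha> \<Longrightarrow> y \<in> gradeL \<alpha> \<Longrightarrow> P x \<Longrightarrow> P y \<Longrightarrow> P (x + y)"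
  shows "P x"
proof (cases "\<alpha> = 0")
  case True
  have "P (p, 0, 0)" for p
  proof (induction p rule: laurent_induct)
    case (1 m v)
    then show ?case using gen[of "tensA v m"] gensI(1)[of v m] True by (simp add: tensA_def)
  next
    case (2 p q)
    then show ?case using add[of "(p, 0, 0)" "(q, 0, 0)"] by (auto simp: gradeL_def True)
  qed
  moreover have "P (0, 0, k)" for k
    using gen[of "scl k cK"] gensI(3)[of k] True by (simp add: scl_cK)
  moreover obtain p k where "x = (p, 0, 0) + (0, 0, k)"
    using x by (auto simp: gradeL_def True)
  ultimately show ?thesis using add[of "(p, 0, 0)" "(0, 0, k)"] by (auto simp: gradeL_def True)
next
  case False
  then have odd: "\<alpha> = 1" by simp
  have "P (0, q, 0)" for q
  proof (induction q rule: laurent_induct)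
    case (1 m v)
    then show ?case using gen[of "tensU v m"] gensI(2)[of v m] odd by (simp add: tensU_def)
  next
    case (2 p q)
    then show ?case using add[of "(0, p, 0)" "(0, q, 0)"] by (auto simp: gradeL_def odd)
  qed
  then show ?thesis using x by (auto simp: gradeL_def odd)
qed

lemma br_cK: "br (scl k cK) x = 0" "br x (scl k cK) = 0"
  by (simp_all add: br_linear br_values)

lemma br_graded:
  assumes "x \<in> gradeL \<alpha>" "y \<in> gradeL \<beta>"
  shows "br x y \<in> gradeL (\<alpha> + \<beta>)"
proof -
  note sub = L.subspace_add[OF subspace_gradeL] L.subspace_neg[OF subspace_gradeL]
    L.subspace_scale[OF subspace_gradeL] L.subspace_0[OF subspace_gradeL] tens_in_gradeL
  from assms(1) show ?thesis
  proof (induction rule: gradeL_induct)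
    case x: (gen x)
    from assms(2) show ?case
    proof (induction rule: gradeL_induct)
      case y: (gen y)
      from x y show ?case
        by (cases \<alpha>; cases \<beta>) (auto simp: gens_def br_cK br_values intro!: sub)
    qed (simp add: br_linear sub)
  qed (simp add: br_linear sub)
qed

definition super_skew :: bool
  where "super_skew \<longleftrightarrow> (\<forall>\<alpha> \<beta>. \<forall>x\<in>(gradeL \<alpha> :: ('a, 'u) superL set).
    \<forall>y\<in>gradeL \<beta>. br x y = - scl (koszul \<alpha> \<beta>) (br y x))"

lemma super_skewI:
  assumes "\<And>\<alpha> \<beta> x y. x \<in> gens \<alpha> \<Longrightarrow> y \<in> gens \<beta> \<Longrightarrow> br x y = - scl (koszul \<alpha> \<beta>) (br y x)"
  shows super_skew
  unfolding super_skew_def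
proof (intro allI ballI)
  fix \<alpha> \<beta> and x y :: "('a, 'u) superL"
  assume x: "x \<in> gradeL \<alpha>" and y: "y \<in> gradeL \<beta>"
  from x show "br x y = - scl (koszul \<alpha> \<beta>) (br y x)"
  proof (induction rule: gradeL_induct)
    case x: (gen x)
    from y show ?case
    proof (induction rule: gradeL_induct)
      case y: (gen y)
      from assms[OF x y] show ?case .
    qed (simp add: br_linear L.scale_right_distrib)
  qed (simp add: br_linear L.scale_right_distrib)
qed

lemma jac_add:
  "jac s (x + x') y z = jac s x y z + jac s x' y z"
  "jac s x (y + y') z = jac s x y z + jac s x y' z"
  "jac s x y (z + z') = jac s x y z + jac s x y z'"
  by (simp_all add: jac_def br_linear L.scale_right_distrib)

lemma jac_cK: "jac s (scl k cK) y z = 0" "jac s x (scl k cK) z = 0" "jac s x y (scl k cK) = 0"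
proof -
  have "br 0 x = 0" "br x 0 = 0" for x by (simp_all add: br_linear)
  then show "jac s (scl k cK) y z = 0" "jac s x (scl k cK) z = 0" "jac s x y (scl k cK) = 0"
    by (simp_all add: jac_def br_cK)
qed

text \<open>In the first case skew-symmetry is used for \<open>[y, x]\<close>. In the second it is used for
  \<open>[z, y]\<close>, \<open>[z, [x, y]]\<close> and \<open>[[x, z], y]\<close>; the signs match because the exponent of the
  Koszul sign is bilinear in the parities, so that
  \<open>(-1)\<^bsup>|x||z|\<^esup> (-1)\<^bsup>|z||x + y|\<^esup> = (-1)\<^bsup>|y||z|\<^esup>\<close>.\<close>

lemma jac_swap:
  assumes super_skew and x: "x \<in> gradeL \<alpha>" and y: "y \<in> gradeL \<beta>" and z: "z \<in> gradeL \<gamma>"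
  shows jac_swap12: "jac (koszul \<beta> \<alpha>) y x z = - scl (koszul \<alpha> \<beta>) (jac (koszul \<alpha> \<beta>) x y z)"
    and jac_swap23: "jac (koszul \<alpha> \<gamma>) x z y = - scl (koszul \<beta> \<gamma>) (jac (koszul \<alpha> \<beta>) x y z)"
proof -
  have sk: "br x y = - scl (koszul \<alpha> \<beta>) (br y x)" if "x \<in> gradeL \<alpha>" "y \<in> gradeL \<beta>" for \<alpha> \<beta> x y
    using assms(1) that unfolding super_skew_def by blast
  have neg: "br (- x) y = - br x y" "br x (- y) = - br x y" for x y
    using br_linear(3)[of "-1" x y] br_linear(4)[of x "-1" y] by simp_all
  show "jac (koszul \<beta> \<alpha>) y x z = - scl (koszul \<alpha> \<beta>) (jac (koszul \<alpha> \<beta>) x y z)"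
    unfolding jac_def sk[OF y x]
    by (cases \<alpha>; cases \<beta>) (simp_all add: neg br_linear)
  show "jac (koszul \<alpha> \<gamma>) x z y = - scl (koszul \<beta> \<gamma>) (jac (koszul \<alpha> \<beta>) x y z)"
    unfolding jac_def sk[OF z y] sk[OF z br_graded[OF x y]] sk[OF br_graded[OF x z] y]
    by (cases \<alpha>; cases \<beta>; cases \<gamma>) (simp_all add: neg br_linear)
qed

lemma gradeL_sum: "\<exists>y\<in>gradeL 0. \<exists>z\<in>gradeL 1. (x :: ('a, 'u) superL) = y + z"
  by (cases x) (auto simp: gradeL_def)

lemma lie_superalgebra_iff:
  "lie_superalgebra scl gradeL br \<longleftrightarrow> super_skew \<and>
    (\<forall>\<alpha> \<beta> z. \<forall>x\<in>gradeL \<alpha>. \<forall>y\<in>gradeL \<beta>. jac (koszul \<alpha> \<beta>) x y z = 0)"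
proof
  assume "lie_superalgebra scl gradeL br"
  then interpret lie_superalgebra scl gradeL br .
  show "super_skew \<and> (\<forall>\<alpha> \<beta> z. \<forall>x\<in>gradeL \<alpha>. \<forall>y\<in>gradeL \<beta>. jac (koszul \<alpha> \<beta>) x y z = 0)"
    unfolding super_skew_def jac_def right_minus_eq using br_skew br_jacobi by blast
next
  assume R: "super_skew \<and> (\<forall>\<alpha> \<beta> z. \<forall>x\<in>gradeL \<alpha>. \<forall>y\<in>gradeL \<beta>. jac (koszul \<alpha> \<beta>) x y z = 0)"
  show "lie_superalgebra scl gradeL br"
  proof (intro lie_superalgebra.intro lie_superalgebra_axioms.intro)
    show "gradeL 0 \<inter> gradeL 1 = {0 :: ('a, 'u) superL}"
      by (auto simp: gradeL_def zero_prod_def)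
    show "br x y = - scl (koszul \<alpha> \<beta>) (br y x)" if "x \<in> gradeL \<alpha>" "y \<in> gradeL \<beta>" for x y \<alpha> \<beta>
      using R that unfolding super_skew_def by blast
    show "br x (br y z) - scl (koszul \<alpha> \<beta>) (br y (br x z)) = br (br x y) z"
      if "x \<in> gradeL \<alpha>" "y \<in> gradeL \<beta>" for x y z \<alpha> \<beta>
      using R that unfolding jac_def right_minus_eq by blast
  qed (fact L.vector_space_axioms subspace_gradeL gradeL_sum bilinear_bracketL[OF bil]
    | rule br_graded; assumption)+
qed

section \<open>The conditions are sufficient\<close>

lemma scale_diff3_eq_0:
  assumes "c1 - c2 - c3 = 0"
  shows "sA c1 x - sA c2 x - sA c3 x = 0" "sU c1 y - sU c2 y - sU c3 y = 0"
  using assms by (simp_all flip: A.scale_left_diff_distrib U.scale_left_diff_distrib)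

context
  assumes mul_comm: "\<And>a b. mul a b = mul b a"
    and mul_assoc: "\<And>a b c. mul (mul a b) c = mul a (mul b c)"
    and formA_sym: "\<And>a b. formA a b = formA b a"
    and formA_assoc: "\<And>a b c. formA (mul a b) c = formA a (mul b c)"
    and act_act: "\<And>a b u. act a (act b u) = act (mul a b) u"
    and formU_sym: "\<And>u v. formU u v = formU v u"
    and circ_sym: "\<And>u v. circ u v = circ v u"
    and formU_act: "\<And>a u v. formU u (act a v) = 4/3 * formA a (circ u v)"
    and circ_act: "\<And>a u v. circ u (act a v) = mul a (circ u v)"
    and act_circ: "\<And>u v w. act (circ u v) w = act (circ v w) u"
begin

text \<open>Both cocycles have the parity that skew-symmetry needs: \<open>m(m-1)(m-2)\<close> changes sign under
  \<open>m \<mapsto> 2 - m\<close>, and \<open>m(m-1)\<close> is invariant under \<open>m \<mapsto> 1 - m\<close>.\<close>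

lemma super_skew: super_skew
proof (rule super_skewI)
  fix \<alpha> \<beta> and x y :: "('a, 'u) superL"
  assume "x \<in> gens \<alpha>" "y \<in> gens \<beta>"
  have AA: "br (tensA a m) (tensA b n) = - br (tensA b n) (tensA a m)" for a b m n
  proof -
    have "m * (m - 1) * (m - 2) = - (n * (n - 1) * (n - 2))" if "m + n = 2"
    proof -
      from that have n: "n = 2 - m" by simp
      show ?thesis unfolding n by (simp add: algebra_simps)
    qed
    then have "of_bool (m + n = 2) * (of_int (m * (m - 1) * (m - 2)) :: complex)
        = - (of_bool (n + m = 2) * of_int (n * (n - 1) * (n - 2)))"
      by (simp add: add.commute del: of_int_mult flip: of_int_minus)
    moreover have "of_int (m - n) / 2 = - (of_int (n - m) / 2 :: complex)"
      by (simp add: field_simps)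
    ultimately show ?thesis
      unfolding br_AA even_monom_minus even_monom_eq_iff mul_comm[of b] formA_sym[of b] add.commute[of n m]
      by (simp only: A.scale_minus_left mult_minus_left divide_minus_left simp_thms)
  qed
  have UU: "br (tensU u m) (tensU v n) = br (tensU v n) (tensU u m)" for u v m n
  proof -
    have "m * (m - 1) = n * (n - 1)" if "m + n = 1"
    proof -
      from that have n: "n = 1 - m" by simp
      show ?thesis unfolding n by (simp add: algebra_simps)
    qed
    then show ?thesis
      unfolding br_UU circ_sym[of v] formU_sym[of v] add.commute[of n m]
      by (cases "m + n = 1") simp_all
  qed
  show "br x y = - scl (koszul \<alpha> \<beta>) (br y x)"
    using \<open>x \<in> gens \<alpha>\<close> \<open>y \<in> gens \<beta>\<close>
    by (cases \<alpha>; cases \<beta>) (auto simp: gens_def br_cK br_values(3) intro: AA UU)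
qed

text \<open>Commutativity and associativity make all three products equal to \<open>a(bc)\<close>, and all three
  values of the form equal to \<open>\<langle>a, bc\<rangle>\<close>. What remains are the Jacobi identity of the Witt algebra
  and the cocycle identity of the Virasoro algebra.\<close>

lemma jac_AAA_eq_0: "jac 1 (tensA a m) (tensA b n) (tensA c p) = 0"
proof -
  have 1: "mul b (mul a c) = mul a (mul b c)" "mul (mul a b) c = mul a (mul b c)"
    by (metis mul_comm mul_assoc)+
  have 2: "formA b (mul a c) = formA a (mul b c)" "formA (mul a b) c = formA a (mul b c)"
    by (metis mul_comm formA_assoc)+
  have 3: "(n - p) * (m * (m - 1) * (m - 2)) - (m - p) * (n * (n - 1) * (n - 2))
      - (m - n) * ((m + n - 1) * (m + n - 2) * (m + n - 3)) = 0" if "m + n + p = 3"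
  proof -
    from that have p: "p = 3 - m - n" by simp
    show ?thesis unfolding p by (simp add: algebra_simps)
  qed
  show ?thesis
    unfolding jac_AAA even_monom_eq_0_iff 1 2
  proof (intro conjI scale_diff3_eq_0)
    show "of_int ((n - p) * (m - n - p + 1)) / 4 - of_int ((m - p) * (n - m - p + 1)) / 4
       - of_int ((m - n) * (m + n - 1 - p)) / 4 = (0::complex)"
      by (simp add: field_simps)
  qed (rule int_scale_diff3_eq_0, rule 3)
qed

lemma jac_AAU_eq_0: "jac 1 (tensA a m) (tensA b n) (tensU u p) = 0"
  unfolding jac_AAU act_act mul_comm[of b a] tensU_eq_0_iff
  by (rule scale_diff3_eq_0) (simp add: field_simps)

text \<open>The cocycle \<open>m(m-1)(m-2)/6\<close> of the even part meets the cocycle \<open>m(m-1)/2\<close> of the odd part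
  here, each of the latter terms carrying a further factor \<open>1/4\<close>. The central term is therefore
  proportional to a polynomial combination with coefficients \<open>1/6\<close>, \<open>1/8\<close>, \<open>1/8\<close>, and the
  factor \<open>4/3\<close> relating the forms is exactly what balances them.\<close>

lemma jac_AUU_eq_0: "jac 1 (tensA a m) (tensU u n) (tensU v p) = 0"
proof -
  have 1: "circ (act a u) v = mul a (circ u v)"
    by (metis circ_sym circ_act)
  have 2: "formU (act a u) v = 4/3 * formA a (circ u v)"
    by (metis formU_sym formU_act circ_sym)
  have 3: "m * (m - 1) * (m - 2) - (m - 2 * p) * (n * (n - 1))
      - (m - 2 * n) * ((m + n - 1) * (m + n - 2)) = 0" if "m + n + p = 2"
  proof -
    from that have p: "p = 2 - m - n" by simp
    show ?thesis unfolding p by (simp add: algebra_simps)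
  qed
  show ?thesis
    unfolding jac_AUU even_monom_eq_0_iff 1 2 circ_act formU_act
  proof (intro conjI scale_diff3_eq_0)
    show "of_int (m - n - p) / 2 - of_int (m - 2 * p) / 4 - of_int (m - 2 * n) / 4 = (0::complex)"
      by (simp add: field_simps)
    show "of_bool (m + n + p = 2) * of_int (m * (m - 1) * (m - 2)) / 6 * formA a (circ u v)
       - of_bool (m + n + p = 2) * of_int ((m - 2 * p) * (n * (n - 1))) / 8 * (4/3 * formA a (circ u v))
       - of_bool (m + n + p = 2) * of_int ((m - 2 * n) * ((m + n - 1) * (m + n - 2))) / 8 * (4/3 * formA a (circ u v)) = 0"
      using int_scale_diff3_eq_0[where Q = "m + n + p = 2", OF 3, where d = 6 and f = "formA a (circ u v)"]
      by (simp add: mult_ac)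
  qed
qed

text \<open>The three coefficients \<open>n + p - 2m\<close>, \<open>m + p - 2n\<close>, \<open>m + n - 2p\<close> add up to zero, so the full
  symmetry of \<open>(u \<circ> v)w\<close> suffices.\<close>

lemma jac_UUU_eq_0: "jac (-1) (tensU u m) (tensU v n) (tensU w p) = 0"
proof -
  have 1: "act (circ v w) u = act (circ u v) w" "act (circ u w) v = act (circ u v) w"
    by (metis act_circ circ_sym)+
  show ?thesis
    unfolding jac_UUU tensU_eq_0_iff 1 U.scale_minus_left[symmetric]
    by (rule scale_diff3_eq_0) (simp add: field_simps)
qed

lemma jac_gens_eq_0:
  assumes x: "x \<in> gens \<alpha>" and y: "y \<in> gens \<beta>" and z: "z \<in> gens \<gamma>"
  shows "jac (koszul \<alpha> \<beta>) x y z = 0"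
proof -
  note t = tens_in_gradeL
  have AUA: "jac 1 (tensA a m) (tensU u n) (tensA b p) = 0" for a m u n b p
    using jac_swap23[OF super_skew t(1,1,2), of a m u n b p] jac_AAU_eq_0 by simp
  have UAA: "jac 1 (tensU u m) (tensA a n) (tensA b p) = 0" for a m u n b p
    using jac_swap12[OF super_skew t(1,2,1), of u m a n b p] AUA by simp
  have UAU: "jac 1 (tensU u m) (tensA a n) (tensU v p) = 0" for a m u n v p
    using jac_swap12[OF super_skew t(1,2,2), of u m a n v p] jac_AUU_eq_0 by simp
  have UUA: "jac (-1) (tensU u m) (tensU v n) (tensA a p) = 0" for a m u n v p
    using jac_swap23[OF super_skew t(2,1,2), of u m v n a p] UAU by simp
  show ?thesis
    using assms
    by (cases \<alpha>; cases \<beta>; cases \<gamma>)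
      (auto simp: gens_def jac_cK AUA UAA UAU UUA jac_AAA_eq_0 jac_AAU_eq_0 jac_AUU_eq_0 jac_UUU_eq_0)
qed

lemma lie_superalgebra_of_conditions: "lie_superalgebra scl gradeL br"
proof -
  have hom: "jac (koszul \<alpha> \<beta>) x y z = 0"
    if x: "x \<in> gradeL \<alpha>" and y: "y \<in> gradeL \<beta>" and z: "z \<in> gradeL \<gamma>" for \<alpha> \<beta> \<gamma> x y z
    using x
  proof (induction rule: gradeL_induct)
    case x: (gen x)
    from y show ?case
    proof (induction rule: gradeL_induct)
      case y: (gen y)
      from z show ?case
      proof (induction rule: gradeL_induct)
        case z: (gen z)
        from jac_gens_eq_0[OF x y z] show ?case .
      qed (simp add: jac_add)
    qed (simp add: jac_add)
  qed (simp add: jac_add)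
  have "jac (koszul \<alpha> \<beta>) x y z = 0" if "x \<in> gradeL \<alpha>" "y \<in> gradeL \<beta>" for \<alpha> \<beta> x y z
  proof -
    obtain z0 z1 where "z0 \<in> gradeL 0" "z1 \<in> gradeL 1" "z = z0 + z1"
      using gradeL_sum by blast
    then show ?thesis using hom[OF that] by (simp add: jac_add)
  qed
  then show ?thesis using super_skew by (simp add: lie_superalgebra_iff)
qed

end

section \<open>The conditions are necessary\<close>

context
  assumes lie: "lie_superalgebra scl gradeL br"
begin

lemma lie_skew: "x \<in> gradeL \<alpha> \<Longrightarrow> y \<in> gradeL \<beta> \<Longrightarrow> br x y = - scl (koszul \<alpha> \<beta>) (br y x)"
  using lie unfolding lie_superalgebra_iff super_skew_def by blast

lemma lie_jac: "x \<in> gradeL \<alpha> \<Longrightarrow> y \<in> gradeL \<beta> \<Longrightarrow> jac (koszul \<alpha> \<beta>) x y z = 0"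
  using lie unfolding lie_superalgebra_iff by blast

text \<open>The exponents \<open>3\<close> and \<open>-1\<close> are distinct and add up to \<open>2\<close>, with \<open>3\<close> outside the zeros
  \<open>0, 1, 2\<close> of the cocycle, so one instance shows both the product and the form.\<close>

lemma lie_even_symmetric:
  "mul a b = mul b a" "formA a b = formA b a"
proof -
  have "br (tensA a 3) (tensA b (-1)) = - br (tensA b (-1)) (tensA a 3)"
    using lie_skew[OF tens_in_gradeL(1) tens_in_gradeL(1), of a 3 b "-1"] by simp
  then show "mul a b = mul b a" "formA a b = formA b a"
    by (simp_all add: br_AA even_monom_minus even_monom_eq_iff)
qed

text \<open>The exponents \<open>2\<close> and \<open>-1\<close> add up to \<open>1\<close>, and \<open>m(m-1)\<close> is nonzero at both.\<close>

lemma lie_odd_symmetric: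
  "circ u v = circ v u" "formU u v = formU v u"
proof -
  have "br (tensU u 2) (tensU v (-1)) = br (tensU v (-1)) (tensU u 2)"
    using lie_skew[OF tens_in_gradeL(2) tens_in_gradeL(2), of u 2 v "-1"] by simp
  then show "circ u v = circ v u" "formU u v = formU v u"
    by (simp_all add: br_UU even_monom_eq_iff)
qed

text \<open>Equal second and third exponents kill the product \<open>b(ac)\<close>. Since \<open>a\<close> and \<open>b\<close> enter the
  Jacobiator in exchanged roles, the two survivors are \<open>a(bc)\<close> and \<open>(ba)c\<close>.\<close>

lemma lie_mul_assoc: "mul (mul a b) c = mul a (mul b c)"
proof -
  have "jac 1 (tensA b 0) (tensA a 1) (tensA c 1) = 0"
    using lie_jac[OF tens_in_gradeL(1) tens_in_gradeL(1)] by simp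
  then show ?thesis
    by (simp add: jac_AAA even_monom_eq_0_iff lie_even_symmetric(1)[of b a] flip: A.scale_right_diff_distrib)
qed

text \<open>Again the first term vanishes because the last two exponents agree. For the central part the
  exponents must add up to \<open>3\<close>, and \<open>n = -1\<close> and \<open>m + n - 1 = 3\<close> avoid the zeros of the cocycle.\<close>

lemma lie_formA_assoc: "formA (mul a b) c = formA a (mul b c)"
proof -
  have "jac 1 (tensA b 5) (tensA a (-1)) (tensA c (-1)) = 0"
    using lie_jac[OF tens_in_gradeL(1) tens_in_gradeL(1)] by simp
  then show ?thesis
    by (simp add: jac_AAA even_monom_eq_0_iff lie_even_symmetric(1)[of b a])
qed

text \<open>The choice \<open>n = 2p\<close> gives \<open>[a t\<^sup>n, u t\<^sup>p] = 0\<close> for the second and third arguments, so that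
  only \<open>a(bu)\<close> and \<open>(ba)u\<close> survive.\<close>

lemma lie_act_act: "act a (act b u) = act (mul a b) u"
proof -
  have "jac 1 (tensA b 2) (tensA a 0) (tensU u 0) = 0"
    using lie_jac[OF tens_in_gradeL(1) tens_in_gradeL(1)] by simp
  then show ?thesis
    by (simp add: jac_AAU tensU_eq_0_iff lie_even_symmetric(1)[of b a] flip: A.scale_right_diff_distrib)
qed

text \<open>Here \<open>m = 2p\<close>, so that \<open>[a t\<^sup>m, v t\<^sup>p] = 0\<close>.\<close>

lemma lie_circ_act: "circ (act a u) v = mul a (circ u v)"
proof -
  have "jac 1 (tensA a 2) (tensU u 0) (tensU v 1) = 0"
    using lie_jac[OF tens_in_gradeL(1) tens_in_gradeL(2)] by simp
  then show ?thesis
    by (simp add: jac_AUU even_monom_eq_0_iff flip: A.scale_right_diff_distrib)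
qed

text \<open>With \<open>n = 0\<close> the odd cocycle kills the term with \<open>\<langle>u, av\<rangle>\<close>; \<open>m = 3\<close> is a nonzero of the even
  cocycle, and \<open>p\<close> is then forced by \<open>m + n + p = 2\<close>. Comparing \<open>1\<close> with \<open>3/4\<close> gives the factor
  \<open>4/3\<close>.\<close>

lemma lie_formU_act: "formU (act a u) v = 4/3 * formA a (circ u v)"
proof -
  have "jac 1 (tensA a 3) (tensU u 0) (tensU v (-1)) = 0"
    using lie_jac[OF tens_in_gradeL(1) tens_in_gradeL(2)] by simp
  then show ?thesis
    by (simp add: jac_AUU even_monom_eq_0_iff field_simps)
qed

text \<open>The choice \<open>n + p = 2m\<close> kills one of the three products. With symmetry of \<open>\<circ>\<close>, the resulting
  transposition generates the full symmetry of \<open>(u \<circ> v)w\<close>.\<close>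

lemma lie_act_circ: "act (circ u v) w = act (circ u w) v"
proof -
  have "jac (-1) (tensU u 0) (tensU w 1) (tensU v (-1)) = 0"
    using lie_jac[OF tens_in_gradeL(2) tens_in_gradeL(2)] by simp
  then have "sU (3/4) (act (circ u v) w) = sU (3/4) (act (circ u w) v)"
    by (simp add: jac_UUU tensU_eq_0_iff U.scale_minus_left)
  then show ?thesis by simp
qed

end

end

theorem theorem4p1:
  fixes sA :: "complex \<Rightarrow> 'a::ab_group_add \<Rightarrow> 'a"
    and sU :: "complex \<Rightarrow> 'u::ab_group_add \<Rightarrow> 'u"
    and mul :: "'a \<Rightarrow> 'a \<Rightarrow> 'a"
    and formA :: "'a \<Rightarrow> 'a \<Rightarrow> complex"
    and act :: "'a \<Rightarrow> 'u \<Rightarrow> 'u"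
    and formU :: "'u \<Rightarrow> 'u \<Rightarrow> complex"
    and circ :: "'u \<Rightarrow> 'u \<Rightarrow> 'a"
  assumes "vector_space sA" and "vector_space sU"
    and "bilinear_map sA sA sA mul"
    and "bilinear_map sA sA (*) formA"
    and "bilinear_map sA sU sU act"
    and "bilinear_map sU sU (*) formU"
    and "bilinear_map sU sU sA circ"
  shows "lie_superalgebra (scaleL sA sU) gradeL (bracketL sA sU mul formA act formU circ) \<longleftrightarrow>
    ((\<forall>a b. mul a b = mul b a) \<and>
     (\<forall>a b c. mul (mul a b) c = mul a (mul b c)) \<and>
     (\<forall>a b. formA a b = formA b a) \<and>
     (\<forall>a b c. formA (mul a b) c = formA a (mul b c))) \<and>
    ((\<forall>a b u. act a (act b u) = act (mul a b) u) \<and>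
     (\<forall>u v. formU u v = formU v u) \<and>
     (\<forall>u v. circ u v = circ v u)) \<and>
    (\<forall>a u v w.
       formU v (act a u) = formU u (act a v) \<and>
       formU u (act a v) = 4/3 * formA a (circ u v) \<and>
       mul a (circ u v) = circ v (act a u) \<and>
       circ v (act a u) = circ u (act a v) \<and>
       act (circ u v) w = act (circ v w) u \<and>
       act (circ v w) u = act (circ w u) v)"
proof -
  interpret superL_data sA sU mul formA act formU circ
    by unfold_locales fact+
  show ?thesis (is "?L \<longleftrightarrow> ?R")
  proof
    assume L: ?L
    note skewA = lie_even_symmetric[OF L] and skewU = lie_odd_symmetric[OF L]
    have circ_act: "mul a (circ u v) = circ u (act a v)"
      "mul a (circ u v) = circ v (act a u)" for a u v
      using lie_circ_act[OF L] skewU(1) by metis+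
    have formU_act: "formU u (act a v) = 4/3 * formA a (circ u v)"
      "formU v (act a u) = 4/3 * formA a (circ u v)" for a u v
      using lie_formU_act[OF L] skewU by metis+
    have act_circ: "act (circ u v) w = act (circ v w) u" "act (circ v w) u = act (circ w u) v" for u v w
      using lie_act_circ[OF L] skewU(1) by metis+
    show ?R
      using skewA skewU lie_mul_assoc[OF L] lie_formA_assoc[OF L] lie_act_act[OF L]
        circ_act formU_act act_circ
      by (intro conjI allI) metis+
  next
    assume R: ?R
    show ?L
      by (rule lie_superalgebra_of_conditions) (use R in metis)+
  qed
qed

end
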